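(* Let $\Omega\subset\mathbb{R}^n$ be a bounded convex domain, $u,\varphi\in C(\overline\Omega)$ convex, and $W\subset\Omega$ a nonempty compact set such that $\mathscr M u(E)\le\mathscr M\varphi(E)$ for every Borel set $E$ with $W\subset E\subset\Omega$. Then $$\max_{x\in W}\{u(x)-\varphi(x)\}\ge\min_{x\in\partial\Omega}\{u(x)-\varphi(x)\}.$$
   Context: $\mathscr M u(E)=|\partial u(E)|$ is the Monge–Ampère measure of a convex function. *)

theory Defs
  imports "HOL-Analysis.Analysis"
begin

text \<open>Subdifferential (set of supporting slopes) of u at x, relative to the domain \<Omega>.\<close>
definition subdiff :: "'a::euclidean_space set \<Rightarrow> ('a \<Rightarrow> real) \<Rightarrow> 'a \<Rightarrow> 'a set" where
  "subdiff \<Omega> u x = {p. \<forall>y\<in>\<Omega>. u y \<ge> u x + inner p (y - x)}"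

text \<open>Monge-Ampere measure: Lebesgue measure of the image of E under the subdifferential.\<close>
definition monge_ampere :: "'a::euclidean_space set \<Rightarrow> ('a \<Rightarrow> real) \<Rightarrow> 'a set \<Rightarrow> ennreal" where
  "monge_ampere \<Omega> u E = emeasure lebesgue (\<Union>x\<in>E. subdiff \<Omega> u x)"

end

theory Submission
  imports Defs
begin

text \<open>Suppose \<open>u - \<phi>\<close> is smaller everywhere on \<open>W\<close> than everywhere on \<open>\<partial>\<Omega>\<close>. Then for
  some \<open>\<kappa> > 1\<close> and \<open>c\<close> the convex function \<open>v = \<kappa> \<phi> + c\<close> lies above \<open>u\<close> on \<open>W\<close> and
  below \<open>u\<close> on \<open>\<partial>\<Omega>\<close>, so \<open>E = {u \<le> v}\<close> is a compact subset of \<open>\<Omega>\<close> containing \<open>W\<close>.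
  Lowering a supporting plane of \<open>v\<close> at a point of \<open>E\<close> until it touches \<open>u\<close> (which can
  only happen in \<open>E\<close>, as \<open>u > v\<close> elsewhere) shows \<open>\<kappa> \<partial>\<phi>(E) \<subseteq> \<partial>u(E)\<close>. Doing the same with
  a strict affine minorant of \<open>v\<close> that exceeds \<open>u\<close> at a point of \<open>W\<close>, every nearby slope
  still touches inside \<open>E\<close>, so \<open>\<partial>u(E)\<close> contains a ball. Hence
  \<open>|\<partial>u(E)| \<ge> \<kappa>\<^sup>n |\<partial>\<phi>(E)|\<close> and \<open>|\<partial>u(E)| > 0\<close> force \<open>|\<partial>u(E)| > |\<partial>\<phi>(E)|\<close>, contradicting
  the hypothesis for the closed set \<open>E\<close>.\<close>

lemma closed_subdiff_image:
  fixes E :: "'a::euclidean_space set" and f :: "'a \<Rightarrow> real"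
  assumes "compact E" "continuous_on E f"
  shows "closed (\<Union>x\<in>E. subdiff \<Omega> f x)"
  unfolding closed_sequential_limits
proof (intro allI impI, elim conjE)
  fix s :: "nat \<Rightarrow> 'a" and l
  assume "\<forall>n. s n \<in> (\<Union>x\<in>E. subdiff \<Omega> f x)" and s: "s \<longlonglongrightarrow> l"
  then have "\<forall>n. \<exists>y. y \<in> E \<and> s n \<in> subdiff \<Omega> f y" by blast
  then obtain x where x: "\<And>n. x n \<in> E" "\<And>n. s n \<in> subdiff \<Omega> f (x n)"
    by metis
  obtain z r where z: "z \<in> E" "strict_mono r" "(x \<circ> r) \<longlonglongrightarrow> z"
    using compact_imp_seq_compact[OF assms(1)] x(1) unfolding seq_compact_def by metis
  have "l \<in> subdiff \<Omega> f z"
    unfolding subdiff_def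
  proof (intro CollectI ballI)
    fix y assume "y \<in> \<Omega>"
    then have "f (x (r n)) + inner (s (r n)) (y - x (r n)) \<le> f y" for n
      using x(2) by (auto simp: subdiff_def)
    moreover have "(\<lambda>n. f (x (r n)) + inner (s (r n)) (y - x (r n))) \<longlonglongrightarrow> f z + inner l (y - z)"
      using continuous_on_tendsto_compose[OF assms(2) z(3) z(1)] x(1)
        LIMSEQ_subseq_LIMSEQ[OF s z(2)] z(3)
      by (auto simp: o_def intro!: tendsto_intros)
    ultimately show "f z + inner l (y - z) \<le> f y"
      by (intro tendsto_le[OF _ tendsto_const]) auto
  qed
  with z(1) show "l \<in> (\<Union>x\<in>E. subdiff \<Omega> f x)" by blast
qed

lemma bounded_subdiff_image:
  fixes \<Omega> E :: "'a::euclidean_space set" and f :: "'a \<Rightarrow> real"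
  assumes "bounded (f ` \<Omega>)" "open \<Omega>" "compact E" "E \<subseteq> \<Omega>"
  shows "bounded (\<Union>x\<in>E. subdiff \<Omega> f x)"
proof -
  obtain B where B: "\<And>y. y \<in> \<Omega> \<Longrightarrow> \<bar>f y\<bar> \<le> B"
    using assms(1) by (auto simp: bounded_iff)
  obtain \<delta> where "0 < \<delta>" and \<delta>: "(\<Union>x\<in>E. cball x \<delta>) \<subseteq> \<Omega>"
    using compact_subset_open_imp_cball_epsilon_subset assms(2-4) by blast
  have "norm p \<le> 2 * B / \<delta>" if x: "x \<in> E" and p: "p \<in> subdiff \<Omega> f x" for x p
  proof (cases "p = 0")
    case True
    then show ?thesis using B[of x] x assms(4) \<open>0 < \<delta>\<close> by force
  next
    case False
    define y where "y = x + (\<delta> / norm p) *\<^sub>R p"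
    have "y \<in> \<Omega>"
      using \<delta> x \<open>0 < \<delta>\<close> False by (force simp: y_def dist_norm)
    then have "f x + inner p (y - x) \<le> f y"
      using p by (auto simp: subdiff_def)
    moreover have "inner p (y - x) = \<delta> * norm p"
      using False by (simp add: y_def dot_square_norm power2_eq_square)
    moreover have "\<bar>f x\<bar> \<le> B" "\<bar>f y\<bar> \<le> B"
      using B \<open>y \<in> \<Omega>\<close> x assms(4) by auto
    ultimately have "\<delta> * norm p \<le> 2 * B" by linarith
    then show ?thesis using \<open>0 < \<delta>\<close> by (simp add: field_simps)
  qed
  then show ?thesis unfolding bounded_iff by blast
qed

lemma compact_subdiff_image:
  fixes \<Omega> E :: "'a::euclidean_space set" and f :: "'a \<Rightarrow> real"
  assumes "open \<Omega>" "bounded \<Omega>" "continuous_on (closure \<Omega>) f" "compact E" "E \<subseteq> \<Omega>"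
  shows "compact (\<Union>x\<in>E. subdiff \<Omega> f x)"
proof -
  have "bounded (f ` \<Omega>)"
    using compact_continuous_image[OF assms(3)] assms(2) closure_subset
    by (meson bounded_subset compact_closure compact_imp_bounded image_mono)
  moreover have "continuous_on E f"
    using assms(3,5) closure_subset by (blast intro: continuous_on_subset)
  ultimately show ?thesis
    unfolding compact_eq_bounded_closed
    using bounded_subdiff_image[OF _ assms(1,4,5)] closed_subdiff_image[OF assms(4)] by blast
qed

lemma slope_in_subdiff_image:
  fixes E :: "'a::euclidean_space set" and u :: "'a \<Rightarrow> real"
  assumes "compact E" "continuous_on E u" "z \<in> E"
    and "\<And>y. y \<in> \<Omega> \<Longrightarrow> y \<notin> E \<Longrightarrow> u z - inner P z \<le> u y - inner P y"
  shows "P \<in> (\<Union>x\<in>E. subdiff \<Omega> u x)"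
proof -
  have "continuous_on E (\<lambda>y. u y - inner P y)"
    using assms(2) by (intro continuous_intros)
  then obtain x where x: "x \<in> E" "\<And>y. y \<in> E \<Longrightarrow> u x - inner P x \<le> u y - inner P y"
    using continuous_attains_inf[OF assms(1)] assms(3) by blast
  have "u x - inner P x \<le> u y - inner P y" if "y \<in> \<Omega>" for y
    using x(2)[of y] x(2)[OF assms(3)] assms(4)[OF that] by (cases "y \<in> E") auto
  then have "P \<in> subdiff \<Omega> u x"
    by (auto simp: subdiff_def inner_diff_right algebra_simps)
  with x(1) show ?thesis by blast
qed

lemma ball_subset_subdiff_image:
  fixes \<Omega> E :: "'a::euclidean_space set" and u :: "'a \<Rightarrow> real"
  assumes "compact E" "continuous_on E u" "z \<in> E" "bounded \<Omega>"
    and "\<And>y. y \<in> \<Omega> \<Longrightarrow> y \<notin> E \<Longrightarrow> \<alpha> + inner P y < u y"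
    and "u z < \<alpha> + inner P z"
  obtains r where "0 < r" "ball P r \<subseteq> (\<Union>x\<in>E. subdiff \<Omega> u x)"
proof -
  obtain B where "0 < B" and B: "\<And>y. y \<in> \<Omega> \<Longrightarrow> norm y \<le> B"
    using assms(4) bounded_pos by blast
  define D where "D = B + norm z"
  have "0 < D" using \<open>0 < B\<close> by (simp add: D_def add_pos_nonneg)
  have D: "norm (y - z) \<le> D" if "y \<in> \<Omega>" for y
    using B[OF that] norm_triangle_ineq4[of y z] by (simp add: D_def)
  define r where "r = (\<alpha> + inner P z - u z) / D"
  have "ball P r \<subseteq> (\<Union>x\<in>E. subdiff \<Omega> u x)"
  proof
    fix Q assume "Q \<in> ball P r"
    then have Q: "norm (Q - P) * D < \<alpha> + inner P z - u z"
      using \<open>0 < D\<close> by (simp add: r_def dist_norm norm_minus_commute field_simps)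
    show "Q \<in> (\<Union>x\<in>E. subdiff \<Omega> u x)"
    proof (rule slope_in_subdiff_image[OF assms(1-3)])
      fix y assume y: "y \<in> \<Omega>" "y \<notin> E"
      have "inner (Q - P) (y - z) \<le> norm (Q - P) * norm (y - z)"
        by (rule norm_cauchy_schwarz)
      also have "\<dots> \<le> norm (Q - P) * D"
        using D[OF y(1)] by (simp add: mult_left_mono)
      finally show "u z - inner Q z \<le> u y - inner Q y"
        using Q assms(5)[OF y] by (simp add: inner_diff_left inner_diff_right)
    qed
  qed
  moreover have "0 < r" using assms(6) \<open>0 < D\<close> by (simp add: r_def)
  ultimately show thesis using that by blast
qed

lemma scaled_subdiff_image_subset:
  fixes E :: "'a::euclidean_space set" and u \<phi> :: "'a \<Rightarrow> real"
  assumes "compact E" "continuous_on E u" "0 \<le> \<kappa>"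
    and "\<And>x. x \<in> E \<Longrightarrow> u x \<le> \<kappa> * \<phi> x + c"
    and "\<And>y. y \<in> \<Omega> \<Longrightarrow> y \<notin> E \<Longrightarrow> \<kappa> * \<phi> y + c < u y"
  shows "(*\<^sub>R) \<kappa> ` (\<Union>x\<in>E. subdiff \<Omega> \<phi> x) \<subseteq> (\<Union>x\<in>E. subdiff \<Omega> u x)"
proof
  fix P assume "P \<in> (*\<^sub>R) \<kappa> ` (\<Union>x\<in>E. subdiff \<Omega> \<phi> x)"
  then obtain z p where z: "z \<in> E" and p: "p \<in> subdiff \<Omega> \<phi> z" and P: "P = \<kappa> *\<^sub>R p"
    by blast
  show "P \<in> (\<Union>x\<in>E. subdiff \<Omega> u x)"
  proof (rule slope_in_subdiff_image[OF assms(1,2) z])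
    fix y assume y: "y \<in> \<Omega>" "y \<notin> E"
    have "\<kappa> * (\<phi> z + inner p (y - z)) \<le> \<kappa> * \<phi> y"
      using p y(1) assms(3) by (auto simp: subdiff_def intro: mult_left_mono)
    then show "u z - inner P z \<le> u y - inner P y"
      using assms(4)[OF z] assms(5)[OF y]
      by (simp add: P inner_diff_right algebra_simps)
  qed
qed

lemma emeasure_less_if_scaled_subset:
  fixes S T :: "'a::euclidean_space set"
  assumes "compact S" "1 < c" "(*\<^sub>R) c ` S \<subseteq> T" "T \<in> sets lebesgue"
    and "0 < r" "ball p r \<subseteq> T"
  shows "emeasure lebesgue S < emeasure lebesgue T"
proof -
  have "emeasure lebesgue ((*\<^sub>R) c ` S) = ennreal (c ^ DIM('a)) * emeasure lebesgue S"
    using emeasure_lebesgue_affine[of c 0 S] assms(2) by (simp add: ennreal_power)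
  then have scaled: "ennreal (c ^ DIM('a)) * emeasure lebesgue S \<le> emeasure lebesgue T"
    using emeasure_mono[OF assms(3,4)] by simp
  show ?thesis
  proof (cases "emeasure lebesgue S = 0")
    case True
    have "0 < emeasure lebesgue (ball p r)"
      using assms(5) by (simp add: emeasure_ball)
    also have "\<dots> \<le> emeasure lebesgue T"
      using assms(6,4) by (rule emeasure_mono)
    finally show ?thesis using True by simp
  next
    case False
    have S: "emeasure lebesgue S = ennreal (measure lebesgue S)"
      using lmeasurable_compact[OF assms(1)] by (simp add: emeasure_eq_measure2)
    with False have "0 < measure lebesgue S"
      using measure_nonneg[of lebesgue S] by (auto simp: order_less_le)
    moreover have "1 < c ^ DIM('a)"
      using assms(2) by (simp add: one_less_power)
    ultimately have "measure lebesgue S < c ^ DIM('a) * measure lebesgue S"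
      by simp
    then have "emeasure lebesgue S < ennreal (c ^ DIM('a)) * emeasure lebesgue S"
      using S assms(2) by (simp add: ennreal_mult[symmetric] ennreal_less_iff)
    then show ?thesis
      using scaled by (rule order_less_le_trans)
  qed
qed

lemma closed_epigraph:
  assumes "closed S" "continuous_on S f"
  shows "closed (epigraph S f)"
proof -
  have "epigraph S f = (S \<times> UNIV) \<inter> (\<lambda>w. snd w - f (fst w)) -` {0..}"
    by (auto simp: epigraph_def)
  moreover have "continuous_on (S \<times> UNIV) (\<lambda>w. snd w - f (fst w))"
    by (intro continuous_intros continuous_on_compose2[OF assms(2)]) auto
  ultimately show ?thesis
    using assms(1) by (metis closed_Times closed_UNIV closed_atLeast continuous_closed_preimage)
qed

lemma convex_on_strict_affine_minorant:
  fixes f :: "'a::euclidean_space \<Rightarrow> real"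
  assumes "convex_on S f" "closed S" "continuous_on S f" "z \<in> S" "t < f z"
  obtains \<alpha> P where "\<And>y. y \<in> S \<Longrightarrow> \<alpha> + inner P y < f y" "t < \<alpha> + inner P z"
proof -
  have "(z, t) \<notin> epigraph S f"
    using assms(5) by (simp add: mem_epigraph)
  then obtain a b where ab: "inner a (z, t) < b" "\<And>w. w \<in> epigraph S f \<Longrightarrow> b < inner a w"
    using separating_hyperplane_closed_point[OF convex_epigraphI[OF assms(1)]
        closed_epigraph[OF assms(2,3)]] by blast
  obtain Q \<beta> where a: "a = (Q, \<beta>)" by fastforce
  have above: "b < inner Q y + \<beta> * f y" if "y \<in> S" for y
    using ab(2)[of "(y, f y)"] that by (simp add: a mem_epigraph)
  have below: "inner Q z + \<beta> * t < b"
    using ab(1) by (simp add: a)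
  have "\<beta> * t < \<beta> * f z"
    using above[OF assms(4)] below by linarith
  then have "0 < \<beta>"
    using assms(5) by (auto simp: mult_less_cancel_left)
  show thesis
  proof
    show "b / \<beta> + inner (- (1 / \<beta>) *\<^sub>R Q) y < f y" if "y \<in> S" for y
      using above[OF that] \<open>0 < \<beta>\<close> by (simp add: field_simps)
    show "t < b / \<beta> + inner (- (1 / \<beta>) *\<^sub>R Q) z"
      using below \<open>0 < \<beta>\<close> by (simp add: field_simps)
  qed
qed

lemma sublevel_set_compact_subset_open:
  fixes \<Omega> :: "'a::heine_borel set" and f g :: "'a \<Rightarrow> real"
  assumes "open \<Omega>" "bounded \<Omega>" "continuous_on (closure \<Omega>) f" "continuous_on (closure \<Omega>) g"
    and "\<And>x. x \<in> frontier \<Omega> \<Longrightarrow> g x < f x"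
  shows "compact {x \<in> closure \<Omega>. f x \<le> g x}" "{x \<in> closure \<Omega>. f x \<le> g x} \<subseteq> \<Omega>"
proof -
  have "{x \<in> closure \<Omega>. f x \<le> g x} = closure \<Omega> \<inter> (\<lambda>x. f x - g x) -` {..0}"
    by auto
  then have "closed {x \<in> closure \<Omega>. f x \<le> g x}"
    using continuous_closed_preimage[OF continuous_on_diff[OF assms(3,4)] closed_closure closed_atMost]
    by simp
  moreover have "bounded {x \<in> closure \<Omega>. f x \<le> g x}"
    using bounded_closure[OF assms(2)] by (rule bounded_subset) auto
  ultimately show "compact {x \<in> closure \<Omega>. f x \<le> g x}"
    by (simp add: compact_eq_bounded_closed)
  show "{x \<in> closure \<Omega>. f x \<le> g x} \<subseteq> \<Omega>"
    using assms(1,5) by (force simp: frontier_def interior_open)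
qed

lemma monge_ampere_less_on_sublevel_set:
  fixes \<Omega> :: "'a::euclidean_space set" and u \<phi> :: "'a \<Rightarrow> real"
  assumes "open \<Omega>" "bounded \<Omega>" "continuous_on (closure \<Omega>) u"
    and "continuous_on (closure \<Omega>) \<phi>" "convex_on (closure \<Omega>) \<phi>" "1 < \<kappa>"
    and "\<And>x. x \<in> frontier \<Omega> \<Longrightarrow> \<kappa> * \<phi> x + c < u x"
    and "z \<in> closure \<Omega>" "u z < \<kappa> * \<phi> z + c"
  defines "E \<equiv> {x \<in> closure \<Omega>. u x \<le> \<kappa> * \<phi> x + c}"
  shows "monge_ampere \<Omega> \<phi> E < monge_ampere \<Omega> u E"
proof -
  define SU where "SU = (\<Union>x\<in>E. subdiff \<Omega> u x)"
  define S\<phi> where "S\<phi> = (\<Union>x\<in>E. subdiff \<Omega> \<phi> x)"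
  have v: "convex_on (closure \<Omega>) (\<lambda>y. \<kappa> * \<phi> y + c)"
    "continuous_on (closure \<Omega>) (\<lambda>y. \<kappa> * \<phi> y + c)"
    using assms(4,5,6)
    by (auto intro!: convex_on_add convex_on_cmul continuous_intros
        simp: convex_on_const dest: convex_on_imp_convex)
  have E: "compact E" "E \<subseteq> \<Omega>"
    unfolding E_def using sublevel_set_compact_subset_open[OF assms(1,2,3) v(2) assms(7)] by auto
  have outside: "\<kappa> * \<phi> y + c < u y" if "y \<in> \<Omega>" "y \<notin> E" for y
    using that closure_subset unfolding E_def by force
  have cont: "continuous_on E u"
    using assms(3) E(2) closure_subset by (blast intro: continuous_on_subset)
  have "z \<in> E"
    using assms(8,9) by (simp add: E_def)
  have scaled: "(*\<^sub>R) \<kappa> ` S\<phi> \<subseteq> SU"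
    unfolding SU_def S\<phi>_def
    by (rule scaled_subdiff_image_subset[OF E(1) cont])
      (use assms(6) outside in \<open>auto simp: E_def\<close>)
  obtain \<alpha> P where minorant: "\<And>y. y \<in> closure \<Omega> \<Longrightarrow> \<alpha> + inner P y < \<kappa> * \<phi> y + c"
    and "u z < \<alpha> + inner P z"
    using convex_on_strict_affine_minorant[OF v(1) closed_closure v(2) assms(8,9)] by blast
  have "\<alpha> + inner P y < u y" if "y \<in> \<Omega>" "y \<notin> E" for y
    using minorant[of y] outside[OF that] that(1) closure_subset by force
  then obtain r where "0 < r" "ball P r \<subseteq> SU"
    using ball_subset_subdiff_image[OF E(1) cont \<open>z \<in> E\<close> assms(2)] \<open>u z < \<alpha> + inner P z\<close>
    unfolding SU_def by blast
  moreover have "compact S\<phi>"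
    unfolding S\<phi>_def by (rule compact_subdiff_image[OF assms(1,2,4) E])
  moreover have "SU \<in> sets lebesgue"
    unfolding SU_def using closed_subdiff_image[OF E(1) cont] by simp
  ultimately show ?thesis
    unfolding monge_ampere_def SU_def[symmetric] S\<phi>_def[symmetric]
    using emeasure_less_if_scaled_subset assms(6) scaled by blast
qed

lemma scaled_shift_separates:
  fixes u \<phi> :: "'a \<Rightarrow> real"
  assumes "bdd_above ((\<lambda>x. u x - \<phi> x) ` W)" "bdd_below ((\<lambda>x. u x - \<phi> x) ` F)"
    and "bounded (\<phi> ` (W \<union> F))"
    and "(SUP x\<in>W. u x - \<phi> x) < (INF x\<in>F. u x - \<phi> x)"
  obtains \<kappa> c where "1 < \<kappa>"
    "\<And>x. x \<in> W \<Longrightarrow> u x < \<kappa> * \<phi> x + c" "\<And>x. x \<in> F \<Longrightarrow> \<kappa> * \<phi> x + c < u x"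
proof -
  define M where "M = (SUP x\<in>W. u x - \<phi> x)"
  define m where "m = (INF x\<in>F. u x - \<phi> x)"
  have M: "u x - \<phi> x \<le> M" if "x \<in> W" for x
    using cSUP_upper[OF that assms(1)] by (simp add: M_def)
  have m: "m \<le> u x - \<phi> x" if "x \<in> F" for x
    using cINF_lower[OF assms(2) that] by (simp add: m_def)
  obtain B where B: "\<And>x. x \<in> W \<union> F \<Longrightarrow> \<bar>\<phi> x\<bar> \<le> B"
    using assms(3) by (auto simp: bounded_iff)
  define \<delta> where "\<delta> = (m - M) / 4"
  define \<epsilon> where "\<epsilon> = \<delta> / (\<bar>B\<bar> + 1)"
  have "M < m" using assms(4) by (simp add: M_def m_def)
  then have "0 < \<delta>" by (simp add: \<delta>_def)
  then have "0 < \<epsilon>" by (simp add: \<epsilon>_def add_nonneg_pos)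
  have "\<epsilon> * (\<bar>B\<bar> + 1) = \<delta>"
    by (simp add: \<epsilon>_def add_nonneg_pos)
  then have "\<epsilon> * \<bar>B\<bar> < \<delta>"
    using \<open>0 < \<epsilon>\<close> by (simp add: distrib_left)
  moreover have "\<bar>\<epsilon> * \<phi> x\<bar> \<le> \<epsilon> * \<bar>B\<bar>" if "x \<in> W \<union> F" for x
    using B[OF that] \<open>0 < \<epsilon>\<close> by (simp add: abs_mult mult_left_mono)
  ultimately have small: "\<bar>\<epsilon> * \<phi> x\<bar> < \<delta>" if "x \<in> W \<union> F" for x
    using that by fastforce
  show thesis
  proof
    show "1 < 1 + \<epsilon>" using \<open>0 < \<epsilon>\<close> by simp
    show "u x < (1 + \<epsilon>) * \<phi> x + (M + m) / 2" if "x \<in> W" for x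
      using M[OF that] small[OF UnI1[OF that]] \<open>M < m\<close>
      by (simp add: \<delta>_def abs_less_iff field_simps)
    show "(1 + \<epsilon>) * \<phi> x + (M + m) / 2 < u x" if "x \<in> F" for x
      using m[OF that] small[OF UnI2[OF that]] \<open>M < m\<close>
      by (simp add: \<delta>_def abs_less_iff field_simps)
  qed
qed

theorem mainTheorem7:
  fixes \<Omega> W :: "'a::euclidean_space set" and u \<phi> :: "'a \<Rightarrow> real"
  assumes "open \<Omega>" "connected \<Omega>" "\<Omega> \<noteq> {}" "bounded \<Omega>" "convex \<Omega>"
    and "continuous_on (closure \<Omega>) u" "convex_on (closure \<Omega>) u"
    and "continuous_on (closure \<Omega>) \<phi>" "convex_on (closure \<Omega>) \<phi>"
    and "compact W" "W \<noteq> {}" "W \<subseteq> \<Omega>"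
    and "\<And>E. E \<in> sets borel \<Longrightarrow> W \<subseteq> E \<Longrightarrow> E \<subseteq> \<Omega> \<Longrightarrow>
           monge_ampere \<Omega> u E \<le> monge_ampere \<Omega> \<phi> E"
  shows "(SUP x\<in>W. u x - \<phi> x) \<ge> (INF x\<in>frontier \<Omega>. u x - \<phi> x)"
proof (rule ccontr)
  assume "\<not> ?thesis"
  then have gap: "(SUP x\<in>W. u x - \<phi> x) < (INF x\<in>frontier \<Omega>. u x - \<phi> x)"
    by simp
  have W: "W \<subseteq> closure \<Omega>" and F: "frontier \<Omega> \<subseteq> closure \<Omega>"
    using assms(12) closure_subset by (auto simp: frontier_def)
  have "compact (frontier \<Omega>)"
    using assms(4) by (simp add: compact_frontier_bounded)
  then have "compact ((\<lambda>x. u x - \<phi> x) ` W)" "compact ((\<lambda>x. u x - \<phi> x) ` frontier \<Omega>)"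
    "compact (\<phi> ` (W \<union> frontier \<Omega>))"
    using W F assms(6,8,10) by (auto intro!: compact_continuous_image continuous_intros
        intro: continuous_on_subset)
  then obtain \<kappa> c where "1 < \<kappa>"
    and below: "\<And>x. x \<in> W \<Longrightarrow> u x < \<kappa> * \<phi> x + c"
    and above: "\<And>x. x \<in> frontier \<Omega> \<Longrightarrow> \<kappa> * \<phi> x + c < u x"
    using scaled_shift_separates[OF bounded_imp_bdd_above bounded_imp_bdd_below _ gap]
      compact_imp_bounded by blast
  define E where "E = {x \<in> closure \<Omega>. u x \<le> \<kappa> * \<phi> x + c}"
  have "continuous_on (closure \<Omega>) (\<lambda>x. \<kappa> * \<phi> x + c)"
    using assms(8) by (intro continuous_intros)
  then have "compact E" "E \<subseteq> \<Omega>"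
    unfolding E_def using sublevel_set_compact_subset_open[OF assms(1,4,6) _ above] by blast+
  moreover have "W \<subseteq> E"
    using W below unfolding E_def by fastforce
  ultimately have "monge_ampere \<Omega> u E \<le> monge_ampere \<Omega> \<phi> E"
    using assms(13) by (simp add: borel_closed compact_imp_closed)
  moreover obtain z where "z \<in> W"
    using assms(11) by blast
  then have "monge_ampere \<Omega> \<phi> E < monge_ampere \<Omega> u E"
    using monge_ampere_less_on_sublevel_set[OF assms(1,4,6,8,9) \<open>1 < \<kappa>\<close> above] W below
    unfolding E_def by blast
  ultimately show False
    by simp
qed

end
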